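(* Let $Y$ be a stable graph of order $n$ whose vertices are ordered so that each cell of its vertex partition $C_1,\dots,C_t$ (vertices with equal diagonal entries of $Y$) consists of consecutive integers, and write $Y=(Y_{ij})_{i,j\in[t]}$ as a block matrix where $Y_{ij}$ is the submatrix with rows in $C_i$ and columns in $C_j$. Let $X=(X_{ij})_{i,j\in[t]}$ be any real $n\times n$ matrix partitioned into blocks in the same way. If $XY=YX$, then $X_{ij}=\mathbf 0$ for all $i\ne j$, and $X_{ii}Y_{ij}=Y_{ij}X_{jj}$ for all $i,j\in[t]$.
   Context: Labels are independent commuting indeterminates $x_0,x_1,\dots$; $\mathrm{Var}=\{x_1,x_2,\dots\}$. A graph of order $n$ is a symmetric $n\times n$ matrix over $\{x_0\}\cup\mathrm{Var}$. Matrix products are computed in the commutative polynomial ring over $\mathbb{R}$ in the indeterminates (and an extra indeterminate $\lambda$). $A\approx B$ means: $a_{ij}=a_{st}\iff b_{ij}=b_{st}$ for all $i,j,s,t$. An equivalent variable substitution replaces the entries of a matrix by variables of $\mathrm{Var}$, equal entries by equal variables and distinct by distinct. The description graph $\tilde Y$ is obtained from $\Gamma(Y)=\sum_{k=0}^{n-1}\lambda^kY^k$ ($Y^0=I$) by an equivalent variable substitution. A graph $Y$ is stable if $\tilde Y\approx Y$. *)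

theory Defs
  imports
    "HOL-Library.Poly_Mapping"
    "Jordan_Normal_Form.Matrix"
    "Jordan_Normal_Form.DL_Submatrix"
begin

text \<open>
  The polynomial ring over the reals in the labels \<open>x\<^sub>0, x\<^sub>1, \<dots>\<close> and in the extra
  indeterminate \<open>\<lambda>\<close>: finitely supported maps from monomials to coefficients.
\<close>

datatype indet = Lambda | Label nat

type_synonym label_poly = "(indet \<Rightarrow>\<^sub>0 nat) \<Rightarrow>\<^sub>0 real"

definition indet_poly :: "indet \<Rightarrow> label_poly" where
  "indet_poly v = Poly_Mapping.single (Poly_Mapping.single v 1) 1"

definition const_poly :: "real \<Rightarrow> label_poly" where
  "const_poly c = Poly_Mapping.single 0 c"

abbreviation lam :: label_poly where
  "lam \<equiv> indet_poly Lambda"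

abbreviation lab :: "nat \<Rightarrow> label_poly" where
  "lab k \<equiv> indet_poly (Label k)"

definition Var :: "label_poly set" where
  "Var = lab ` {1..}"

definition is_graph :: "nat \<Rightarrow> label_poly mat \<Rightarrow> bool" where
  "is_graph n Y \<longleftrightarrow>
     Y \<in> carrier_mat n n \<and> transpose_mat Y = Y \<and> elements_mat Y \<subseteq> insert (lab 0) Var"

definition mat_equiv :: "'a mat \<Rightarrow> 'b mat \<Rightarrow> bool" (infix \<open>\<approx>\<close> 50) where
  "A \<approx> B \<longleftrightarrow> dim_row A = dim_row B \<and> dim_col A = dim_col B \<and>
     (\<forall>i < dim_row A. \<forall>j < dim_col A. \<forall>s < dim_row A. \<forall>t < dim_col A.
        A $$ (i, j) = A $$ (s, t) \<longleftrightarrow> B $$ (i, j) = B $$ (s, t))"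

text \<open>
  \<open>B\<close> is a result of an equivalent variable substitution applied to \<open>A\<close>.  The choice of the
  variables is free, so this is a relation; its results are unique up to \<open>\<approx>\<close>.
\<close>

definition equiv_var_subst :: "label_poly mat \<Rightarrow> label_poly mat \<Rightarrow> bool" where
  "equiv_var_subst A B \<longleftrightarrow> elements_mat B \<subseteq> Var \<and> A \<approx> B"

definition Gamma_mat :: "label_poly mat \<Rightarrow> label_poly mat" where
  "Gamma_mat Y = mat (dim_row Y) (dim_row Y)
     (\<lambda>(i, j). \<Sum>k < dim_row Y. lam ^ k * (Y ^\<^sub>m k) $$ (i, j))"

definition is_description_graph :: "label_poly mat \<Rightarrow> label_poly mat \<Rightarrow> bool" where
  "is_description_graph Y Z \<longleftrightarrow> equiv_var_subst (Gamma_mat Y) Z"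

text \<open>
  A description graph always exists, and whether it is equivalent to \<open>Y\<close> does not depend on
  its choice; see the two lemmas below.
\<close>

definition stable_graph :: "label_poly mat \<Rightarrow> bool" where
  "stable_graph Y \<longleftrightarrow> (\<exists>Z. is_description_graph Y Z \<and> Z \<approx> Y)"

definition vertex_partition :: "label_poly mat \<Rightarrow> nat set set" where
  "vertex_partition Y = {..<dim_row Y} //
     {(u, v). u < dim_row Y \<and> v < dim_row Y \<and> Y $$ (u, u) = Y $$ (v, v)}"

definition consecutive :: "nat set \<Rightarrow> bool" where
  "consecutive S \<longleftrightarrow> (\<exists>a b. S = {a..<b})"

lemma inj_lab: "inj lab"
proof (rule injI)
  fix k l assume "lab k = lab l"
  then have "Poly_Mapping.keys (lab k) = Poly_Mapping.keys (lab l)"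
    by simp
  then have "Poly_Mapping.single (Label k) (1::nat) = Poly_Mapping.single (Label l) 1"
    by (simp add: indet_poly_def)
  then have "Poly_Mapping.keys (Poly_Mapping.single (Label k) (1::nat)) =
             Poly_Mapping.keys (Poly_Mapping.single (Label l) (1::nat))"
    by simp
  then show "k = l"
    by simp
qed

lemma description_graph_exists: "\<exists>Z. is_description_graph Y Z"
proof -
  let ?A = "Gamma_mat Y"
  have "finite (elements_mat ?A)"
    by (simp add: elements_mat_def)
  then obtain f :: "label_poly \<Rightarrow> nat" where f: "inj_on f (elements_mat ?A)"
    using finite_imp_inj_to_nat_seg by blast
  define Z where "Z = map_mat (\<lambda>p. lab (Suc (f p))) ?A"
  have "elements_mat Z \<subseteq> Var"
    by (auto simp: elements_mat_def Z_def Var_def)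
  moreover have "?A \<approx> Z"
    unfolding mat_equiv_def
  proof (intro conjI allI impI)
    fix i j s t
    assume b: "i < dim_row ?A" "j < dim_col ?A" "s < dim_row ?A" "t < dim_col ?A"
    then have "?A $$ (i, j) \<in> elements_mat ?A" "?A $$ (s, t) \<in> elements_mat ?A"
      by (blast intro: elements_matI[OF carrier_matI[OF refl refl] _ _ refl])+
    then show "?A $$ (i, j) = ?A $$ (s, t) \<longleftrightarrow> Z $$ (i, j) = Z $$ (s, t)"
      using b f inj_lab by (auto simp: Z_def inj_on_def)
  qed (simp_all add: Z_def)
  ultimately show ?thesis
    by (auto simp: is_description_graph_def equiv_var_subst_def)
qed

lemma stable_graph_iff_all: "stable_graph Y \<longleftrightarrow> (\<forall>Z. is_description_graph Y Z \<longrightarrow> Z \<approx> Y)"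
proof
  assume "stable_graph Y"
  then show "\<forall>Z. is_description_graph Y Z \<longrightarrow> Z \<approx> Y"
    by (auto simp: stable_graph_def is_description_graph_def equiv_var_subst_def mat_equiv_def)
next
  assume "\<forall>Z. is_description_graph Y Z \<longrightarrow> Z \<approx> Y"
  then show "stable_graph Y"
    using description_graph_exists[of Y] unfolding stable_graph_def by blast
qed

end

theory Submission
  imports Defs
begin

text \<open>
  The constant terms of the entries of \<open>\<Gamma>(Y)\<close> are those of \<open>Y\<^sup>0 = I\<close>, so in a stable graph no
  diagonal label occurs off the diagonal.  Hence, for vertices \<open>i\<close>, \<open>j\<close> in different cells, the
  coefficient of the label \<open>y\<^sub>j\<^sub>j\<close> in \<open>(XY)\<^sub>i\<^sub>j\<close> is \<open>x\<^sub>i\<^sub>j\<close>, while in \<open>(YX)\<^sub>i\<^sub>j\<close> it is \<open>0\<close>.  Thus \<open>X\<close> is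
  block diagonal, and comparing blocks of \<open>XY = YX\<close> gives the rest.
\<close>

section \<open>Constant terms, and the labels on the diagonal of a stable graph\<close>

lemma poly_mapping_add_eq_0_iff:
  fixes a b :: "'a \<Rightarrow>\<^sub>0 nat"
  shows "a + b = 0 \<longleftrightarrow> a = 0 \<and> b = 0"
  by (metis add.right_neutral add_eq_0_iff_both_eq_0 lookup_add lookup_zero poly_mapping_eqI)

text \<open>Exponents are natural numbers, so a product of two monomials is trivial only if both
  are. Hence constant terms multiply.\<close>

lemma lookup_mult_0:
  fixes p q :: "('a \<Rightarrow>\<^sub>0 nat) \<Rightarrow>\<^sub>0 'b::semiring_0"
  shows "Poly_Mapping.lookup (p * q) 0 = Poly_Mapping.lookup p 0 * Poly_Mapping.lookup q 0"
proof -
  have split: "(0 = l + m) \<longleftrightarrow> l = 0 \<and> m = 0" for l m :: "'a \<Rightarrow>\<^sub>0 nat"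
    using poly_mapping_add_eq_0_iff[of l m] by auto
  have "Sum_any (\<lambda>m. Poly_Mapping.lookup q m when 0 = l + m) = (Poly_Mapping.lookup q 0 when l = 0)" for l
    unfolding split by (cases "l = 0") simp_all
  then have "Poly_Mapping.lookup (p * q) 0 = Sum_any (\<lambda>l. Poly_Mapping.lookup p l * Poly_Mapping.lookup q 0 when l = 0)"
    unfolding lookup_mult by (simp add: mult_when)
  then show ?thesis
    by simp
qed

lemma lookup_0_indet_poly [simp]: "Poly_Mapping.lookup (indet_poly v) 0 = 0"
proof -
  have "Poly_Mapping.single v (1::nat) \<noteq> 0"
    by (metis lookup_single_eq lookup_zero zero_neq_one)
  then show ?thesis
    by (simp add: indet_poly_def lookup_single_not_eq)
qed

lemma lookup_0_indet_poly_power: "Poly_Mapping.lookup (indet_poly v ^ k) 0 = (if k = 0 then 1 else 0)"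
  by (cases k) (simp_all add: lookup_mult_0)

text \<open>Every summand with \<open>k > 0\<close> carries a factor \<open>lam ^ k\<close> without
  constant term; the summand for \<open>k = 0\<close> is the identity matrix.\<close>

lemma lookup_0_Gamma_mat:
  assumes "Y \<in> carrier_mat n n" "i < n" "j < n"
  shows "Poly_Mapping.lookup (Gamma_mat Y $$ (i, j)) 0 = (if i = j then 1 else 0)"
proof -
  have "Poly_Mapping.lookup (Gamma_mat Y $$ (i, j)) 0 =
      (\<Sum>k<n. (if k = 0 then 1 else 0) * Poly_Mapping.lookup ((Y ^\<^sub>m k) $$ (i, j)) 0)"
    using assms by (simp add: Gamma_mat_def lookup_sum lookup_mult_0 lookup_0_indet_poly_power)
  \<comment> \<open>Since \<open>i < n\<close>, the order \<open>n\<close> is positive and the index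
    \<open>0\<close> does occur in the sum.\<close>
  also have "\<dots> = (\<Sum>k\<in>{0}. (if k = 0 then 1 else 0) * Poly_Mapping.lookup ((Y ^\<^sub>m k) $$ (i, j)) 0)"
    using assms by (intro sum.mono_neutral_right) auto
  finally show ?thesis
    using assms by simp
qed

text \<open>The chain \<open>Gamma_mat Y \<approx> Z \<approx> Y\<close> would turn such a
  coincidence in \<open>Y\<close> into one in \<open>Gamma_mat Y\<close>, where constant terms
  separate the diagonal from the rest.\<close>

lemma stable_graph_diag_neq_offdiag:
  assumes "stable_graph Y" "Y \<in> carrier_mat n n"
    and "i < n" "j < n" "k < n" "i \<noteq> j"
  shows "Y $$ (i, j) \<noteq> Y $$ (k, k)"
proof
  assume eq: "Y $$ (i, j) = Y $$ (k, k)"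
  from assms(1) obtain Z :: "label_poly mat" where Z: "Gamma_mat Y \<approx> Z" "Z \<approx> Y"
    unfolding stable_graph_def is_description_graph_def equiv_var_subst_def by blast
  have "dim_row Y = n" "dim_col Y = n"
    using assms(2) by auto
  with Z eq assms have "Gamma_mat Y $$ (i, j) = Gamma_mat Y $$ (k, k)"
    by (simp add: mat_equiv_def)
  then show False
    using lookup_0_Gamma_mat[OF assms(2)] assms by (metis zero_neq_one)
qed

section \<open>Coefficients of a label in the entries of the two products\<close>

lemma lookup_const_mult_lab:
  "Poly_Mapping.lookup (const_poly x * lab c) (Poly_Mapping.single (Label d) 1) = (if lab c = lab d then x else 0)"
proof -
  have "lab c = lab d \<longleftrightarrow> c = d"
    by (rule inj_eq[OF inj_lab])
  moreover have "Poly_Mapping.single (Label c) (1::nat) = Poly_Mapping.single (Label d) 1 \<longleftrightarrow> c = d"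
    by (metis indet.inject lookup_single_eq lookup_single_not_eq zero_neq_one)
  ultimately show ?thesis
    unfolding const_poly_def indet_poly_def mult_single lookup_single when_def by simp
qed

lemma graph_entry_lab:
  assumes "is_graph n Y" "i < n" "j < n"
  obtains c where "Y $$ (i, j) = lab c"
proof -
  have "Y \<in> carrier_mat n n" "elements_mat Y \<subseteq> insert (lab 0) Var"
    using assms(1) by (auto simp: is_graph_def)
  then have "Y $$ (i, j) \<in> range lab"
    using assms(2,3) elements_matI[of Y n n i j] unfolding Var_def by blast
  then show thesis
    using that by blast
qed

text \<open>The condition compares polynomials rather than label indices, so it can be evaluated
  directly from the entries of \<open>Y\<close>.\<close>

lemma lookup_const_mult_graph_entry:
  assumes "is_graph n Y" "i < n" "j < n"
  shows "Poly_Mapping.lookup (const_poly x * Y $$ (i, j)) (Poly_Mapping.single (Label d) 1) =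
    (if Y $$ (i, j) = lab d then x else 0)"
  using graph_entry_lab[OF assms] lookup_const_mult_lab by metis

lemma index_mult_mat_sum:
  assumes "A \<in> carrier_mat l m" "B \<in> carrier_mat m n" "i < l" "j < n"
  shows "(A * B) $$ (i, j) = (\<Sum>k<m. A $$ (i, k) * B $$ (k, j))"
  using assms by (auto simp: scalar_prod_def lessThan_atLeast0)

lemma commuting_entry_eq_0:
  assumes "is_graph n Y" "stable_graph Y" "X \<in> carrier_mat n n"
    and comm: "map_mat const_poly X * Y = Y * map_mat const_poly X"
    and "i < n" "j < n" "Y $$ (i, i) \<noteq> Y $$ (j, j)"
  shows "X $$ (i, j) = 0"
proof -
  have Y: "Y \<in> carrier_mat n n"
    using assms(1) by (simp add: is_graph_def)
  have P: "map_mat const_poly X \<in> carrier_mat n n"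
    using assms(3) by simp
  obtain d where d: "Y $$ (j, j) = lab d"
    using graph_entry_lab assms by metis
  let ?c = "\<lambda>p. Poly_Mapping.lookup p (Poly_Mapping.single (Label d) 1) :: real"
  have diag: "Y $$ (k, l) = lab d \<Longrightarrow> k = l" if "k < n" "l < n" for k l
    using stable_graph_diag_neq_offdiag[OF assms(2) Y that \<open>j < n\<close>] d by auto
  have "(map_mat const_poly X * Y) $$ (i, j) = (\<Sum>k<n. const_poly (X $$ (i, k)) * Y $$ (k, j))"
    unfolding index_mult_mat_sum[OF P Y \<open>i < n\<close> \<open>j < n\<close>] using assms
    by (intro sum.cong) simp_all
  then have "?c ((map_mat const_poly X * Y) $$ (i, j)) =
      (\<Sum>k<n. if Y $$ (k, j) = lab d then X $$ (i, k) else 0)"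
    \<comment> \<open>Unfolding \<open>1\<close> to \<open>Suc 0\<close> in the monomial would keep
      the coefficient lemma from matching.\<close>
    using assms by (simp add: lookup_sum lookup_const_mult_graph_entry del: One_nat_def)
  \<comment> \<open>The label \<open>lab d\<close> occurs only on the diagonal of \<open>Y\<close>,
    so column \<open>j\<close> has it exactly in row \<open>j\<close>.\<close>
  also have "\<dots> = (\<Sum>k<n. if k = j then X $$ (i, k) else 0)"
    using diag d assms by (intro sum.cong) auto
  also have "\<dots> = X $$ (i, j)"
    using assms by simp
  finally have left: "?c ((map_mat const_poly X * Y) $$ (i, j)) = X $$ (i, j)" .
  have "(Y * map_mat const_poly X) $$ (i, j) = (\<Sum>k<n. const_poly (X $$ (k, j)) * Y $$ (i, k))"
    unfolding index_mult_mat_sum[OF Y P \<open>i < n\<close> \<open>j < n\<close>] using assms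
    by (intro sum.cong) (simp_all add: mult.commute)
  then have "?c ((Y * map_mat const_poly X) $$ (i, j)) =
      (\<Sum>k<n. if Y $$ (i, k) = lab d then X $$ (k, j) else 0)"
    using assms by (simp add: lookup_sum lookup_const_mult_graph_entry del: One_nat_def)
  \<comment> \<open>Row \<open>i\<close> could have \<open>lab d\<close> only in column
    \<open>i\<close>, but the diagonal entry there differs from that of \<open>j\<close>.\<close>
  also have "\<dots> = 0"
    using diag d assms by (intro sum.neutral) auto
  finally show ?thesis
    using left comm by simp
qed

section \<open>Cells, submatrices and block multiplication\<close>

lemma vertex_partition_subset: "S \<in> vertex_partition Y \<Longrightarrow> S \<subseteq> {..<dim_row Y}"
  by (auto simp: vertex_partition_def quotient_def)

lemma vertex_partition_eqI:
  assumes "S \<in> vertex_partition Y" "T \<in> vertex_partition Y" "u \<in> S" "v \<in> T"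
    and "Y $$ (u, u) = Y $$ (v, v)"
  shows "S = T"
  using assms by (auto simp: vertex_partition_def quotient_def)

lemma bij_betw_pick:
  assumes "finite I"
  shows "bij_betw (pick I) {..<card I} I"
proof -
  have "pick I ` {..<card I} \<subseteq> I"
    using pick_in_set_le by blast
  moreover have "inj_on (pick I) {..<card I}"
    \<comment> \<open>The position of an element is recovered by counting the smaller elements of
      \<open>I\<close>.\<close>
    by (rule inj_on_inverseI[where g = "\<lambda>m. card {a \<in> I. a < m}"]) (simp add: card_pick_le)
  ultimately show ?thesis
    using assms by (metis bij_betw_def card_image card_lessThan card_subset_eq)
qed

lemma submatrix_eq_mat:
  assumes "A \<in> carrier_mat m n" "I \<subseteq> {..<m}" "J \<subseteq> {..<n}"
  shows "submatrix A I J = mat (card I) (card J) (\<lambda>(i, j). A $$ (pick I i, pick J j))"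
proof -
  have "{i. i < m \<and> i \<in> I} = I" "{j. j < n \<and> j \<in> J} = J"
    using assms by auto
  then show ?thesis
    using assms by (simp add: submatrix_def)
qed

lemma map_mat_submatrix:
  assumes "A \<in> carrier_mat m n" "I \<subseteq> {..<m}" "J \<subseteq> {..<n}"
  shows "map_mat f (submatrix A I J) = submatrix (map_mat f A) I J"
proof -
  have "pick I i < m" if "i < card I" for i
    using pick_in_set_le[OF that] assms by auto
  moreover have "pick J j < n" if "j < card J" for j
    using pick_in_set_le[OF that] assms by auto
  ultimately show ?thesis
    using assms
    by (intro eq_matI) (auto simp: submatrix_eq_mat[OF assms]
        submatrix_eq_mat[OF map_carrier_mat[THEN iffD2, OF assms(1)] assms(2,3)])
qed

text \<open>Inner indices outside \<open>K\<close> contribute nothing, so a block of the product is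
  a single product of blocks. The vanishing is asked of the products of entries, so that either
  factor may supply it.\<close>

lemma submatrix_mult:
  fixes A B :: "'a::semiring_0 mat"
  assumes A: "A \<in> carrier_mat l m" and B: "B \<in> carrier_mat m n"
    and I: "I \<subseteq> {..<l}" and K: "K \<subseteq> {..<m}" and J: "J \<subseteq> {..<n}"
    and zero: "\<And>i k j. \<lbrakk>i \<in> I; k < m; k \<notin> K; j \<in> J\<rbrakk> \<Longrightarrow> A $$ (i, k) * B $$ (k, j) = 0"
  shows "submatrix (A * B) I J = submatrix A I K * submatrix B K J"
proof (rule eq_matI)
  note sub = submatrix_eq_mat[OF A I K] submatrix_eq_mat[OF B K J]
    submatrix_eq_mat[OF mult_carrier_mat[OF A B] I J]
  show "dim_row (submatrix (A * B) I J) = dim_row (submatrix A I K * submatrix B K J)"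
    and "dim_col (submatrix (A * B) I J) = dim_col (submatrix A I K * submatrix B K J)"
    by (simp_all add: sub)
  fix i j
  assume "i < dim_row (submatrix A I K * submatrix B K J)"
    and "j < dim_col (submatrix A I K * submatrix B K J)"
  then have ij: "i < card I" "j < card J"
    by (simp_all add: sub)
  then have pick: "pick I i \<in> I" "pick J j \<in> J"
    by (simp_all add: pick_in_set_le)
  have "finite K"
    using K finite_subset by blast
  have "submatrix (A * B) I J $$ (i, j) = (\<Sum>k<m. A $$ (pick I i, k) * B $$ (k, pick J j))"
    using index_mult_mat_sum[OF A B] I J ij pick by (simp add: sub subset_iff)
  also have "\<dots> = (\<Sum>k\<in>K. A $$ (pick I i, k) * B $$ (k, pick J j))"
    using K zero pick by (intro sum.mono_neutral_right) auto
  \<comment> \<open>\<open>pick K\<close> enumerates \<open>K\<close>, which turns the sum over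
    \<open>K\<close> into the inner sum of the block product.\<close>
  also have "\<dots> = (\<Sum>k<card K. A $$ (pick I i, pick K k) * B $$ (pick K k, pick J j))"
    using sum.reindex_bij_betw[OF bij_betw_pick[OF \<open>finite K\<close>],
        of "\<lambda>k. A $$ (pick I i, k) * B $$ (k, pick J j)"] by simp
  also have "\<dots> = (submatrix A I K * submatrix B K J) $$ (i, j)"
    using ij by (simp add: sub scalar_prod_def lessThan_atLeast0)
  finally show "submatrix (A * B) I J $$ (i, j) = (submatrix A I K * submatrix B K J) $$ (i, j)" .
qed

theorem theorem6:
  fixes n t :: nat and Y :: "label_poly mat" and X :: "real mat" and C :: "nat \<Rightarrow> nat set"
  assumes "is_graph n Y"
    and "stable_graph Y"
    and "bij_betw C {1..t} (vertex_partition Y)"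
    and "\<forall>i\<in>{1..t}. consecutive (C i)"
    and "X \<in> carrier_mat n n"
    and "map_mat const_poly X * Y = Y * map_mat const_poly X"
  shows "(\<forall>i\<in>{1..t}. \<forall>j\<in>{1..t}. i \<noteq> j \<longrightarrow>
            submatrix X (C i) (C j) = 0\<^sub>m (card (C i)) (card (C j))) \<and>
         (\<forall>i\<in>{1..t}. \<forall>j\<in>{1..t}.
            map_mat const_poly (submatrix X (C i) (C i)) * submatrix Y (C i) (C j) =
            submatrix Y (C i) (C j) * map_mat const_poly (submatrix X (C j) (C j)))"
proof -
  note X = assms(5)
  have Y: "Y \<in> carrier_mat n n"
    using assms(1) by (simp add: is_graph_def)
  let ?P = "map_mat const_poly X"
  have P: "?P \<in> carrier_mat n n"
    using X by simp
  have cell: "C i \<in> vertex_partition Y" if "i \<in> {1..t}" for i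
    using bij_betwE[OF assms(3)] that by blast
  have sub: "C i \<subseteq> {..<n}" if "i \<in> {1..t}" for i
    using vertex_partition_subset[OF cell[OF that]] Y by simp
  have zero: "X $$ (u, v) = 0"
    if "S \<in> vertex_partition Y" "T \<in> vertex_partition Y" "u \<in> S" "v \<in> T" "S \<noteq> T" for S T u v
  proof -
    have "u < n" "v < n"
      using that vertex_partition_subset Y by fastforce+
    moreover have "Y $$ (u, u) \<noteq> Y $$ (v, v)"
      using vertex_partition_eqI that by blast
    ultimately show ?thesis
      using commuting_entry_eq_0 assms by blast
  qed
  \<comment> \<open>The cells cover all vertices, so an index outside \<open>C i\<close> lies in
    another cell and \<open>zero\<close> applies to it.\<close>
  have ex: "\<exists>S\<in>vertex_partition Y. u \<in> S" if "u < n" for u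
    using that Y by (fastforce simp: vertex_partition_def quotient_def)
  have const_0: "const_poly 0 = 0"
    by (simp add: const_poly_def)
  have "submatrix X (C i) (C j) = 0\<^sub>m (card (C i)) (card (C j))"
    if i: "i \<in> {1..t}" and j: "j \<in> {1..t}" and "i \<noteq> j" for i j
  proof -
    have "C i \<noteq> C j"
      using that bij_betw_imp_inj_on[OF assms(3)] by (meson inj_onD)
    then show ?thesis
      unfolding submatrix_eq_mat[OF X sub[OF i] sub[OF j]]
      using zero[OF cell[OF i] cell[OF j]] by (intro eq_matI) (auto simp: pick_in_set_le)
  qed
  moreover have "map_mat const_poly (submatrix X (C i) (C i)) * submatrix Y (C i) (C j) =
      submatrix Y (C i) (C j) * map_mat const_poly (submatrix X (C j) (C j))"
    if i: "i \<in> {1..t}" and j: "j \<in> {1..t}" for i j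
  proof -
    note map = map_mat_submatrix[OF X sub sub]
    have row: "?P $$ (u, k) = 0" if "u \<in> C i" "k < n" "k \<notin> C i" for u k
      using zero[OF cell[OF i]] ex[OF \<open>k < n\<close>] that sub[OF i] X const_0 by fastforce
    have col: "?P $$ (k, v) = 0" if "v \<in> C j" "k < n" "k \<notin> C j" for k v
      using zero[OF _ cell[OF j]] ex[OF \<open>k < n\<close>] that sub[OF j] X const_0 by fastforce
    \<comment> \<open>Here the inner index set is \<open>C i\<close>: rows of \<open>?P\<close>
      indexed by \<open>C i\<close> vanish outside it.\<close>
    have "map_mat const_poly (submatrix X (C i) (C i)) * submatrix Y (C i) (C j) =
        submatrix (?P * Y) (C i) (C j)"
      unfolding map[OF i i]
      by (rule submatrix_mult[OF P Y sub[OF i] sub[OF i] sub[OF j], symmetric]) (metis row mult_zero_left)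
    also have "\<dots> = submatrix (Y * ?P) (C i) (C j)"
      using assms(6) by simp
    \<comment> \<open>Now \<open>?P\<close> is the right factor, and its columns indexed by
      \<open>C j\<close> vanish outside \<open>C j\<close>, which is the inner index set.\<close>
    also have "\<dots> = submatrix Y (C i) (C j) * map_mat const_poly (submatrix X (C j) (C j))"
      unfolding map[OF j j]
      by (rule submatrix_mult[OF Y P sub[OF i] sub[OF j] sub[OF j]]) (metis col mult_zero_right)
    finally show ?thesis .
  qed
  ultimately show ?thesis
    by blast
qed

end
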